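(* Let $\Bbbk$ be a field and $0\ne v\in\Bbbk$ with $[n]!\ne0$ in $\Bbbk$. Let $\alpha$ be a $1$-factor of length less than $n$ with $d=i_\alpha$ defects, and assume that $d>0$ in part (b). Then: (a) $\Phi_1\eta(\alpha)=\eta(\alpha^+)$. (b) $\Phi_2\eta(\alpha)=\sum_{j=1}^d[j]\,\eta(\alpha^{+(j)})=[d]\,\eta(\alpha^-)+\sum_{j=1}^{d-1}[j]\,\eta(\alpha^{(j)+})$.
   Context: Quantum integers: for $k\ge0$, $[k]=\sum_{t=0}^{k-1}v^{k-1-2t}\in\Bbbk$, $[-k]=-[k]$, $[k]!=[1][2]\cdots[k]$, $[0]!=1$. $V$ is the two-dimensional space with basis $y_1,y_{-1}$ and operators $Fy_1=y_{-1}$, $Fy_{-1}=0$, $Ky_{\pm1}=v^{\pm1}y_{\pm1}$. On $V^{\otimes m}$, $F$ acts as $\sum_{j=1}^m1^{\otimes(j-1)}\otimes F\otimes(K^{-1})^{\otimes(m-j)}$; $y_{i_1}\otimes\cdots\otimes y_{i_m}$ ($i_j\in\{\pm1\}$) has weight $\sum_ji_j$. ($V^{\otimes0}=\Bbbk$, of weight $0$, with $F=0$.) For $b\in V^{\otimes(m-1)}$ of weight $i_b$, $\Phi_1(b)=b\otimes y_1$ and $\Phi_2(b)=[i_b]\,b\otimes y_{-1}-v^{i_b}Fb\otimes y_1$. A $1$-factor of length $l$ is a sequence $\alpha=(\alpha_1,\dots,\alpha_l)$ with $\alpha_i=\pm1$ and all partial sums $\alpha_1+\cdots+\alpha_i\ge0$;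 $i_\alpha$ is the sum of its entries. If $\alpha_i=1$ and $j$ is the smallest index with $i<j\le l$ and $\alpha_i+\cdots+\alpha_j=0$, then $(i,j)$ is a pairing of $\alpha$; unpaired indices are called defects (there are $i_\alpha$ of them). $\alpha^+$, $\alpha^-$ denote $\alpha$ with $1$, respectively $-1$, appended at the end. For $1\le j\le i_\alpha-1$, $\alpha^{(j)}$ is the $1$-factor obtained by pairing the $j$th defect of $\alpha$ with the next one (changing the entry at the $(j+1)$st defect to $-1$). $\alpha^{+(j)}=(\alpha^+)^{(j)}$ and $\alpha^{(j)+}=(\alpha^{(j)})^+$. $\eta(\alpha)\in V^{\otimes l}$ is the tensor product, in order, of a factor $y_1$ for each defect and of nested links; explicitly: $\eta(\emptyset)=1$; if index $1$ is a defect, $\eta(\alpha)=y_1\otimes\eta(\alpha_2,\dots,\alpha_l)$; if $1$ is paired with $j$, $\eta(\alpha)=\Psi(\eta(\alpha_2,\dots,\alpha_{j-1}))\otimes\eta(\alpha_{j+1},\dots,\alpha_l)$, where $\Psi(b)=y_1\otimes b\otimes y_{-1}-v\,y_{-1}\otimes b\otimes y_1$. It has weight $i_\alpha$. *)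

theory Defs
  imports Main "HOL-Library.Function_Algebras"
begin

definition qint :: "'k::field \<Rightarrow> int \<Rightarrow> 'k" where
  "qint v k = (if 0 \<le> k then (\<Sum>t<nat k. v powi (k - 1 - 2 * int t))
               else - (\<Sum>t<nat (- k). v powi (- k - 1 - 2 * int t)))"

definition qfact :: "'k::field \<Rightarrow> nat \<Rightarrow> 'k" where
  "qfact v n = (\<Prod>k=1..n. qint v (int k))"

text \<open>
  Elements of tensor powers of \<open>V\<close> are given by their coordinates: the word
  \<open>[i\<^sub>1, \<dots>, i\<^sub>m]\<close> over \<open>{1, -1}\<close> stands for the basis vector
  \<open>y\<^bsub>i\<^sub>1\<^esub> \<otimes> \<dots> \<otimes> y\<^bsub>i\<^sub>m\<^esub>\<close>, and \<open>V\<^sup>\<otimes>\<^sup>m\<close> consists of the functions vanishing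
  outside \<open>words m\<close>. Addition and subtraction are the pointwise ones. All tensor
  powers share one type, so the tensor product is the multiplication of the tensor
  algebra: on \<open>V\<^sup>\<otimes>\<^sup>a \<times> V\<^sup>\<otimes>\<^sup>b\<close> only the summand \<open>k = a\<close> below can be nonzero.
\<close>

type_synonym 'k tens = "int list \<Rightarrow> 'k"

definition words :: "nat \<Rightarrow> int list set" where
  "words m = {w. length w = m \<and> set w \<subseteq> {1, -1}}"

definition smul :: "'k::field \<Rightarrow> 'k tens \<Rightarrow> 'k tens" where
  "smul c b = (\<lambda>w. c * b w)"

definition tens_one :: "'k::field tens" where
  "tens_one = (\<lambda>w. if w = [] then 1 else 0)"

definition yvec :: "int \<Rightarrow> 'k::field tens" where
  "yvec i = (\<lambda>w. if w = [i] then 1 else 0)"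

definition tensor :: "'k::field tens \<Rightarrow> 'k tens \<Rightarrow> 'k tens" (infixr "\<otimes>\<^sub>T" 75) where
  "b \<otimes>\<^sub>T c = (\<lambda>w. \<Sum>k\<le>length w. b (take k w) * c (drop k w))"

text \<open>
  An operator on \<open>V\<close> is represented by the images \<open>A i\<close> of the basis vectors \<open>y\<^sub>i\<close>.
  Recall that \<open>K y\<^sub>i = v\<^sup>i y\<^sub>i\<close>.
\<close>

definition idV :: "int \<Rightarrow> 'k::field tens" where
  "idV i = yvec i"

definition FV :: "int \<Rightarrow> 'k::field tens" where
  "FV i = (if i = 1 then yvec (-1) else 0)"

definition KinvV :: "'k::field \<Rightarrow> int \<Rightarrow> 'k tens" where
  "KinvV v i = smul (v powi (- i)) (yvec i)"

text \<open>The operator \<open>A\<^sub>1 \<otimes> \<dots> \<otimes> A\<^sub>m\<close> on \<open>V\<^sup>\<otimes>\<^sup>m\<close>, extended linearly from the basis.\<close>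

definition tensor_op :: "(int \<Rightarrow> 'k::field tens) list \<Rightarrow> 'k tens \<Rightarrow> 'k tens" where
  "tensor_op As b =
     (\<Sum>w\<in>words (length As). smul (b w) (foldr (\<otimes>\<^sub>T) (map2 (\<lambda>A i. A i) As w) tens_one))"

text \<open>The degree-\<open>m\<close> component of the result is the action on \<open>V\<^sup>\<otimes>\<^sup>m\<close>, whence \<open>m = length u\<close>.\<close>

definition F_op :: "'k::field \<Rightarrow> 'k tens \<Rightarrow> 'k tens" where
  "F_op v b = (\<lambda>u. let m = length u in
     \<Sum>j=1..m. tensor_op (replicate (j - 1) idV @ [FV] @ replicate (m - j) (KinvV v)) b u)"

definition has_weight :: "'k::field tens \<Rightarrow> int \<Rightarrow> bool" where
  "has_weight b i \<longleftrightarrow> (\<forall>w. b w \<noteq> 0 \<longrightarrow> sum_list w = i)"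

text \<open>
  Meaningful for nonzero weight vectors. The zero vector has every weight, but
  \<open>Phi2\<close> below sends it to zero whichever value is used.
\<close>

definition weight :: "'k::field tens \<Rightarrow> int" where
  "weight b = (THE i. has_weight b i)"

definition Phi1 :: "'k::field tens \<Rightarrow> 'k tens" where
  "Phi1 b = b \<otimes>\<^sub>T yvec 1"

definition Phi2 :: "'k::field \<Rightarrow> 'k tens \<Rightarrow> 'k tens" where
  "Phi2 v b = smul (qint v (weight b)) (b \<otimes>\<^sub>T yvec (-1))
              - smul (v powi weight b) (F_op v b \<otimes>\<^sub>T yvec 1)"

definition one_factor :: "int list \<Rightarrow> bool" where
  "one_factor \<alpha> \<longleftrightarrow> set \<alpha> \<subseteq> {1, -1} \<and> (\<forall>i\<le>length \<alpha>. 0 \<le> sum_list (take i \<alpha>))"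

text \<open>Positions in a \<open>1\<close>-factor are counted from \<open>0\<close>; defects are numbered from \<open>1\<close>.\<close>

definition pairing :: "int list \<Rightarrow> nat \<Rightarrow> nat \<Rightarrow> bool" where
  "pairing \<alpha> i j \<longleftrightarrow> i < j \<and> j < length \<alpha> \<and> \<alpha> ! i = 1 \<and> (\<Sum>k=i..j. \<alpha> ! k) = 0 \<and>
     (\<forall>j'. i < j' \<and> j' < j \<longrightarrow> (\<Sum>k=i..j'. \<alpha> ! k) \<noteq> 0)"

definition defects :: "int list \<Rightarrow> nat list" where
  "defects \<alpha> = sorted_list_of_set
     {i. i < length \<alpha> \<and> (\<forall>j. \<not> pairing \<alpha> i j \<and> \<not> pairing \<alpha> j i)}"

text \<open>\<open>defects \<alpha> ! j\<close> is the position of the \<open>(j+1)\<close>st defect, since list indices start at \<open>0\<close>.\<close>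

definition pair_defect :: "nat \<Rightarrow> int list \<Rightarrow> int list" where
  "pair_defect j \<alpha> = \<alpha>[defects \<alpha> ! j := -1]"

definition app_plus :: "int list \<Rightarrow> int list" where
  "app_plus \<alpha> = \<alpha> @ [1]"

definition app_minus :: "int list \<Rightarrow> int list" where
  "app_minus \<alpha> = \<alpha> @ [-1]"

definition Psi :: "'k::field \<Rightarrow> 'k tens \<Rightarrow> 'k tens" where
  "Psi v b = yvec 1 \<otimes>\<^sub>T b \<otimes>\<^sub>T yvec (-1) - smul v (yvec (-1) \<otimes>\<^sub>T b \<otimes>\<^sub>T yvec 1)"

text \<open>
  In the second equation \<open>j\<close> is the partner of position \<open>0\<close>: \<open>take (j - 1) as\<close> holds the
  entries strictly between the two, \<open>drop j as\<close> those after \<open>j\<close>. The first entry of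
  a nonempty \<open>1\<close>-factor is \<open>1\<close>, so it is a defect precisely when it has no partner to its right.
\<close>

function eta :: "'k::field \<Rightarrow> int list \<Rightarrow> 'k tens" where
  "eta v [] = tens_one"
| "eta v (a # as) =
     (if \<exists>j. pairing (a # as) 0 j
      then let j = (THE j. pairing (a # as) 0 j)
           in Psi v (eta v (take (j - 1) as)) \<otimes>\<^sub>T eta v (drop j as)
      else yvec 1 \<otimes>\<^sub>T eta v as)"
  by pat_completeness auto
termination
  by (relation "measure (\<lambda>(v, \<alpha>). length \<alpha>)") auto

end

theory Submission imports Defs begin

text \<open>
  The map \<open>\<eta>\<close> turns concatenation of \<open>1\<close>-factors into the tensor product
  (\<open>eta_append\<close>), because a defect of the left factor stays a defect when its right neighbour
  never drops below height \<open>0\<close>. Part (a) is the case of the right factor \<open>(1)\<close>.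

  For part (b) the last defect of \<open>\<alpha>\<close> is split off: \<open>\<alpha>\<close> is \<open>\<beta>\<close>, then \<open>1\<close>, then \<open>B\<close>, where \<open>\<beta>\<close> is
  a \<open>1\<close>-factor with \<open>d - 1\<close> defects and \<open>B\<close> is balanced, that is, a \<open>1\<close>-factor of sum \<open>0\<close>. So
  \<open>\<eta>(\<alpha>) = b \<otimes> y\<^sub>1 \<otimes> e\<close> with \<open>b = \<eta>(\<beta>)\<close> and \<open>e = \<eta>(B)\<close>. The operator \<open>F\<close> is a twisted derivation,
  \<open>F(a \<otimes> c) = a \<otimes> F c + F a \<otimes> K\<inverse> c\<close> (\<open>low_tensor\<close>), and it annihilates links and hence \<open>e\<close>.
  Therefore \<open>F \<eta>(\<alpha>) = b \<otimes> y\<^bsub>-1\<^esub> \<otimes> e + v\<inverse> F b \<otimes> y\<^sub>1 \<otimes> e\<close>. Substituting this into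
  \<open>\<Phi>\<^sub>2\<close>, and expressing \<open>F b \<otimes> y\<^sub>1\<close> through \<open>\<Phi>\<^sub>2 b\<close>, gives
  \<open>\<Phi>\<^sub>2 \<eta>(\<alpha>) = [d] b \<otimes> \<Psi>(e) + \<Phi>\<^sub>2 b \<otimes> e \<otimes> y\<^sub>1\<close> (\<open>Phi2_eta_last_defect\<close>); the coefficients of
  \<open>b \<otimes> y\<^bsub>-1\<^esub> \<otimes> e \<otimes> y\<^sub>1\<close> agree since \<open>v [d] = [d-1] + v\<^sup>d\<close>. The first summand is
  \<open>[d] \<eta>(\<alpha>\<^sup>-)\<close>. By induction on \<open>d\<close> the second is the sum of the \<open>[j] \<eta>(\<beta>\<^bsup>+(j)\<^esup>) \<otimes> e \<otimes> y\<^sub>1\<close>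
  for \<open>j < d\<close>, and appending \<open>B\<close> and \<open>1\<close> to \<open>\<beta>\<^bsup>+(j)\<^esup>\<close> gives \<open>\<alpha>\<^bsup>+(j)\<^esup>\<close>.

  That the \<open>j\<close>-th operation only sees the part of the \<open>1\<close>-factor containing the
  \<open>(j+1)\<close>st defect (\<open>pair_defect_append\<close>) rests on \<open>defects_append\<close>: the defects of a
  concatenation are those of the left factor followed by the shifted ones of the right factor.
\<close>

section \<open>The tensor algebra in coordinates\<close>

lemma tensor_Nil: "(b \<otimes>\<^sub>T c) [] = b [] * c []"
  by (simp add: tensor_def)

text \<open>
  The coefficient of the product at a word is computed by recursion on the word, after splitting
  off the cut at its front. This gives associativity by induction, with the left argument
  generalized.
\<close>

lemma tensor_Cons:
  "(b \<otimes>\<^sub>T c) (x # w) = b [] * c (x # w) + ((\<lambda>u. b (x # u)) \<otimes>\<^sub>T c) w"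
  by (simp add: tensor_def sum.atMost_Suc_shift del: sum.atMost_Suc)

lemma tensor_add_left: "(a + b) \<otimes>\<^sub>T c = a \<otimes>\<^sub>T c + b \<otimes>\<^sub>T c"
  by (rule ext) (simp add: tensor_def sum.distrib algebra_simps)

lemma tensor_diff_left: "(a - b) \<otimes>\<^sub>T c = a \<otimes>\<^sub>T c - b \<otimes>\<^sub>T c"
  by (rule ext) (simp add: tensor_def sum_subtractf algebra_simps)

lemma tensor_diff_right: "a \<otimes>\<^sub>T (b - c) = a \<otimes>\<^sub>T b - a \<otimes>\<^sub>T c"
  by (rule ext) (simp add: tensor_def sum_subtractf algebra_simps)

lemma tensor_smul_left: "smul k a \<otimes>\<^sub>T c = smul k (a \<otimes>\<^sub>T c)"
  by (rule ext) (simp add: tensor_def smul_def sum_distrib_left algebra_simps)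

lemma tensor_smul_right: "a \<otimes>\<^sub>T smul k c = smul k (a \<otimes>\<^sub>T c)"
  by (rule ext) (simp add: tensor_def smul_def sum_distrib_left algebra_simps)

lemma tensor_zero_left: "0 \<otimes>\<^sub>T c = 0"
  by (rule ext) (simp add: tensor_def)

lemma tensor_zero_right: "c \<otimes>\<^sub>T 0 = 0"
  by (rule ext) (simp add: tensor_def)

lemma smul_zero: "smul k 0 = 0"
  by (rule ext) (simp add: smul_def)

lemma tensor_sum_left:
  "finite A \<Longrightarrow> (\<Sum>i\<in>A. f i) \<otimes>\<^sub>T c = (\<Sum>i\<in>A. f i \<otimes>\<^sub>T c)"
proof (induction A rule: finite_induct)
  case empty
  show ?case by (simp only: sum.empty tensor_zero_left)
next
  case (insert i A)
  then show ?case by (simp only: sum.insert tensor_add_left not_False_eq_True)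
qed

lemma tensor_assoc: "(a \<otimes>\<^sub>T b) \<otimes>\<^sub>T c = a \<otimes>\<^sub>T (b \<otimes>\<^sub>T c)"
proof
  fix w show "((a \<otimes>\<^sub>T b) \<otimes>\<^sub>T c) w = (a \<otimes>\<^sub>T (b \<otimes>\<^sub>T c)) w"
  proof (induction w arbitrary: a)
    case (Cons x w)
    have "(\<lambda>u. (a \<otimes>\<^sub>T b) (x # u)) = smul (a []) (\<lambda>u. b (x # u)) + (\<lambda>u. a (x # u)) \<otimes>\<^sub>T b"
      by (rule ext) (simp add: tensor_Cons smul_def)
    then show ?case
      using Cons
      by (simp add: tensor_Cons[of "a \<otimes>\<^sub>T b"] tensor_Cons[of a "b \<otimes>\<^sub>T c"] tensor_Cons[of b c]
          tensor_Nil tensor_add_left tensor_smul_left)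
        (simp add: smul_def algebra_simps)
  qed (simp add: tensor_Nil)
qed

lemma tens_one_left: "tens_one \<otimes>\<^sub>T b = b"
proof
  fix w :: "int list"
  have "(\<lambda>u. tens_one (x # u)) = (0 :: 'a tens)" for x
    by (rule ext) (simp add: tens_one_def)
  then show "(tens_one \<otimes>\<^sub>T b) w = b w"
    by (cases w) (simp_all add: tensor_Nil tensor_Cons tensor_zero_left, simp_all add: tens_one_def)
qed

lemma tens_one_right: "b \<otimes>\<^sub>T tens_one = b"
proof
  fix w show "(b \<otimes>\<^sub>T tens_one) w = b w"
    by (induction w arbitrary: b) (simp_all add: tensor_Nil tensor_Cons, simp_all add: tens_one_def)
qed

text \<open>
  For a homogeneous left factor only one cut of the word contributes, so coefficients multiply.
\<close>

lemma tensor_append: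
  assumes "\<And>u'. b u' \<noteq> 0 \<Longrightarrow> length u' = length u"
  shows "(b \<otimes>\<^sub>T c) (u @ w) = b u * c w"
proof -
  have "(b \<otimes>\<^sub>T c) (u @ w)
      = (\<Sum>k\<in>{length u}. b (take k (u @ w)) * c (drop k (u @ w)))"
    unfolding tensor_def
    by (intro sum.mono_neutral_right) (use assms in \<open>fastforce+\<close>)
  then show ?thesis by simp
qed

lemma tensor_singletons_Cons:
  assumes "\<And>u. b u \<noteq> 0 \<Longrightarrow> length u = 1"
  shows "(b \<otimes>\<^sub>T c) (x # w) = b [x] * c w"
  using tensor_append[of b "[x]" c w] assms by simp

lemma tensor_support:
  assumes "(b \<otimes>\<^sub>T c) w \<noteq> 0"
  obtains u u' where "w = u @ u'" "b u \<noteq> 0" "c u' \<noteq> 0"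
proof -
  obtain k where "b (take k w) * c (drop k w) \<noteq> 0"
    using assms unfolding tensor_def by (meson sum.neutral)
  then show thesis
    using that[of "take k w" "drop k w"] by simp
qed

section \<open>The lowering operator\<close>

definition Kinv :: "'k::field \<Rightarrow> 'k tens \<Rightarrow> 'k tens" where
  "Kinv v b = (\<lambda>w. v powi (- sum_list w) * b w)"

text \<open>
  The operator \<open>F\<close> in coordinates, by recursion on the word at which the result is evaluated.
  Either \<open>F\<close> hits the first tensor factor, so that this factor is now \<open>y\<^bsub>-1\<^esub>\<close>, was \<open>y\<^sub>1\<close>
  before, and \<open>K\<inverse>\<close> acts on all the others; or the first factor stays and \<open>F\<close> acts further right.
\<close>

fun low :: "'k::field \<Rightarrow> 'k tens \<Rightarrow> 'k tens" where
  "low v b [] = 0"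
| "low v b (x # u) =
     (if x = -1 then Kinv v (\<lambda>w. b (1 # w)) u else 0) + low v (\<lambda>w. b (x # w)) u"

lemma low_zero: "low v (\<lambda>w. 0) u = 0"
  by (induction u) (simp_all add: Kinv_def)

text \<open>
  Peeling the first letter off a basis vector \<open>y\<^sub>i\<close> leaves the unit or zero; the guard covers both.
\<close>

lemma low_one: "low v (\<lambda>w. if P \<and> w = [] then 1 else 0) u = 0"
  by (cases u) (simp_all add: Kinv_def low_zero)

lemma low_tens_one: "low v tens_one = 0"
  unfolding tens_one_def using low_one[of v True] by (intro ext) simp

lemma sum_tens_apply: "(\<Sum>i\<in>A. f i) w = (\<Sum>i\<in>A. f i w)" for f :: "'i \<Rightarrow> 'k::field tens"
  by (induction A rule: infinite_finite_induct) simp_all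

lemma words_0: "words 0 = {[]}"
  by (auto simp: words_def)

lemma finite_words: "finite (words m)"
  using finite_lists_length_eq[of "{1, -1 :: int}" m] unfolding words_def
  by (simp add: conj_commute)

lemma words_Suc: "words (Suc m) = (\<lambda>w. 1 # w) ` words m \<union> (\<lambda>w. -1 # w) ` words m"
  by (force simp: words_def length_Suc_conv)

text \<open>
  Peeling the first of the operators off a tensor product of operators is what matches the explicit
  sum defining \<open>F\<close> with the recursion of \<open>low\<close>.
\<close>

lemma tensor_op_Cons:
  assumes "\<forall>i u. A i u \<noteq> 0 \<longrightarrow> length u = 1"
  shows "tensor_op (A # As) b (x # u) =
           A 1 [x] * tensor_op As (\<lambda>w. b (1 # w)) u + A (-1) [x] * tensor_op As (\<lambda>w. b (-1 # w)) u"
proof -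
  have "tensor_op (A # As) b (x # u) =
      (\<Sum>w\<in>(\<lambda>w. 1 # w) ` words (length As).
          b w * foldr (\<otimes>\<^sub>T) (map2 (\<lambda>A i. A i) (A # As) w) tens_one (x # u))
    + (\<Sum>w\<in>(\<lambda>w. -1 # w) ` words (length As).
          b w * foldr (\<otimes>\<^sub>T) (map2 (\<lambda>A i. A i) (A # As) w) tens_one (x # u))"
    unfolding tensor_op_def sum_tens_apply
    by (simp add: words_Suc smul_def, subst sum.union_disjoint) (auto simp: finite_words)
  then show ?thesis
    by (simp add: sum.reindex tensor_singletons_Cons assms tensor_op_def sum_tens_apply
        smul_def sum_distrib_left mult_ac)
qed

lemma tensor_op_Kinv:
  assumes "v \<noteq> 0" "\<And>w. b w \<noteq> 0 \<Longrightarrow> set w \<subseteq> {1, -1}"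
  shows "tensor_op (replicate (length u) (KinvV v)) b u = Kinv v b u"
  using assms(2)
proof (induction u arbitrary: b)
  case Nil
  then show ?case by (simp add: tensor_op_def words_0 Kinv_def smul_def tens_one_def)
next
  case (Cons x u)
  have sp: "\<forall>i w. KinvV v i w \<noteq> 0 \<longrightarrow> length w = 1"
    by (auto simp: KinvV_def smul_def yvec_def split: if_splits)
  have IH: "tensor_op (replicate (length u) (KinvV v)) (\<lambda>w. b (y # w)) u
      = Kinv v (\<lambda>w. b (y # w)) u" for y
    using Cons.prems by (intro Cons.IH) fastforce
  have "b (x # u) = 0" if "x \<noteq> 1" "x \<noteq> -1"
    using Cons.prems[of "x # u"] that by auto
  have "tensor_op (replicate (length (x # u)) (KinvV v)) b (x # u)
      = KinvV v 1 [x] * Kinv v (\<lambda>w. b (1 # w)) u + KinvV v (-1) [x] * Kinv v (\<lambda>w. b (-1 # w)) u"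
    by (simp add: tensor_op_Cons[OF sp] IH)
  also have "\<dots> = Kinv v b (x # u)"
    using assms(1) \<open>x \<noteq> 1 \<Longrightarrow> x \<noteq> -1 \<Longrightarrow> b (x # u) = 0\<close>
    by (auto simp: Kinv_def KinvV_def smul_def yvec_def power_int_add
        power_int_diff power_int_minus field_simps)
  finally show ?case .
qed

text \<open>
  The summand \<open>j = 1\<close> of \<open>F\<close> is the case where \<open>F\<close> hits the first factor; all the others have the
  identity in front, and together they are \<open>F\<close> on the remaining factors. The restriction to words
  over \<open>{1, -1}\<close> is needed because \<open>low\<close> would also act on tensors with other letters, on which
  \<open>F_op\<close> vanishes.
\<close>

lemma F_op_eq_low:
  assumes "v \<noteq> 0" "\<And>w. b w \<noteq> 0 \<Longrightarrow> set w \<subseteq> {1, -1}"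
  shows "F_op v b = low v b"
proof
  fix u show "F_op v b u = low v b u"
    using assms(2)
  proof (induction u arbitrary: b)
    case Nil
    then show ?case by (simp add: F_op_def)
  next
    case (Cons x u)
    let ?m = "length u"
    let ?ops = "\<lambda>j. replicate (j - 1) idV @ [FV] @ replicate (?m - j) (KinvV v)"
    have spF: "\<forall>i w. FV i w \<noteq> (0::'a) \<longrightarrow> length w = 1"
      and spI: "\<forall>i w. idV i w \<noteq> (0::'a) \<longrightarrow> length w = 1"
      by (auto simp: FV_def idV_def yvec_def split: if_splits)
    have supp: "\<And>w. b (y # w) \<noteq> 0 \<Longrightarrow> set w \<subseteq> {1, -1}" for y
      using Cons.prems by fastforce
    have Kinv_part: "tensor_op (replicate ?m (KinvV v)) (\<lambda>w. b (y # w)) u = Kinv v (\<lambda>w. b (y # w)) u" for y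
      by (rule tensor_op_Kinv[OF assms(1)]) (rule supp)
    have outside: "low v (\<lambda>w. b (x # w)) u = 0" if "x \<noteq> 1" "x \<noteq> -1"
    proof -
      have "(\<lambda>w. b (x # w)) = (\<lambda>w. 0)"
        using Cons.prems that by fastforce
      then show ?thesis by (simp add: low_zero)
    qed
    have "F_op v b (x # u) = tensor_op (FV # replicate ?m (KinvV v)) b (x # u)
        + (\<Sum>j=1..?m. tensor_op (idV # ?ops j) b (x # u))"
    proof -
      have "F_op v b (x # u) = (\<Sum>j=1..Suc ?m.
          tensor_op (replicate (j - 1) idV @ [FV] @ replicate (Suc ?m - j) (KinvV v)) b (x # u))"
        by (simp add: F_op_def Let_def)
      also have "\<dots> = tensor_op (FV # replicate ?m (KinvV v)) b (x # u)
        + (\<Sum>j=1..?m. tensor_op (replicate j idV @ [FV] @ replicate (?m - j) (KinvV v)) b (x # u))"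
        by (subst sum.atLeast_Suc_atMost) (simp_all add: sum.shift_bounds_cl_Suc_ivl del: sum.cl_ivl_Suc)
      also have "(\<Sum>j=1..?m. tensor_op (replicate j idV @ [FV] @ replicate (?m - j) (KinvV v)) b (x # u))
         = (\<Sum>j=1..?m. tensor_op (idV # ?ops j) b (x # u))"
      proof (rule sum.cong[OF refl])
        fix j assume "j \<in> {1..?m}"
        then obtain i where "j = Suc i" by (cases j) auto
        then show "tensor_op (replicate j idV @ [FV] @ replicate (?m - j) (KinvV v)) b (x # u)
          = tensor_op (idV # ?ops j) b (x # u)" by simp
      qed
      finally show ?thesis .
    qed
    also have "tensor_op (FV # replicate ?m (KinvV v)) b (x # u)
        = (if x = -1 then Kinv v (\<lambda>w. b (1 # w)) u else 0)"
      unfolding tensor_op_Cons[OF spF] Kinv_part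
      by (simp add: FV_def yvec_def)
    also have "(\<Sum>j=1..?m. tensor_op (idV # ?ops j) b (x # u))
        = idV 1 [x] * F_op v (\<lambda>w. b (1 # w)) u + idV (-1) [x] * F_op v (\<lambda>w. b (-1 # w)) u"
      by (simp only: tensor_op_Cons[OF spI] F_op_def Let_def sum.distrib sum_distrib_left)
    also have "\<dots> = low v (\<lambda>w. b (x # w)) u"
      using outside by (auto simp: Cons.IH[OF supp] idV_def yvec_def)
    finally show ?case by simp
  qed
qed

lemma low_smul_add: "low v (smul k b + c) u = k * low v b u + low v c u"
proof (induction u arbitrary: b c)
  case (Cons x u)
  have "(\<lambda>w. (smul k b + c) (y # w)) = smul k (\<lambda>w. b (y # w)) + (\<lambda>w. c (y # w))" for y
    by (rule ext) (simp add: smul_def)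
  then show ?case
    by (simp add: Cons) (simp add: Kinv_def smul_def algebra_simps)
qed simp

lemma low_diff: "low v (b - c) = low v b - low v c"
proof -
  have "b - c = smul (-1) c + b"
    by (rule ext) (simp add: smul_def)
  then have "low v (b - c) u = - low v c u + low v b u" for u
    by (simp only: low_smul_add) simp
  then show ?thesis
    by (intro ext) simp
qed

lemma low_smul: "low v (smul k b) = smul k (low v b)"
proof
  fix u
  have "low v 0 u = 0"
    using low_diff[of v 0 0] by simp
  then show "low v (smul k b) u = smul k (low v b) u"
    using low_smul_add[of v k b 0 u] by (simp add: smul_def)
qed

lemma low_yvec: "low v (yvec 1) = yvec (-1)" "low v (yvec (-1)) = 0"
proof -
  have "low v (yvec 1) u = yvec (-1) u" "low v (yvec (-1)) u = 0" for u
    by (cases u; simp add: yvec_def Kinv_def low_zero low_one)+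
  then show "low v (yvec 1) = yvec (-1)" "low v (yvec (-1)) = 0"
    by auto
qed

lemma Kinv_tensor:
  assumes "v \<noteq> 0"
  shows "Kinv v (b \<otimes>\<^sub>T c) = Kinv v b \<otimes>\<^sub>T Kinv v c"
proof
  fix w
  have "v powi (- sum_list w)
      = v powi (- sum_list (take k w)) * v powi (- sum_list (drop k w))" for k
  proof -
    have "sum_list w = sum_list (take k w) + sum_list (drop k w)"
      by (metis append_take_drop_id sum_list_append)
    then show ?thesis
      using assms by (simp add: power_int_diff power_int_minus field_simps power_int_add)
  qed
  then show "Kinv v (b \<otimes>\<^sub>T c) w = (Kinv v b \<otimes>\<^sub>T Kinv v c) w"
    by (simp add: Kinv_def tensor_def sum_distrib_left mult_ac)
qed

text \<open>
  The coproduct rule for \<open>F\<close>. It is proved by peeling the first letter off the word, which cuts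
  either between the two factors (when \<open>b\<close> contributes its constant coefficient) or inside \<open>b\<close>.
\<close>

lemma low_tensor:
  assumes "v \<noteq> 0"
  shows "low v (b \<otimes>\<^sub>T c) = b \<otimes>\<^sub>T low v c + low v b \<otimes>\<^sub>T Kinv v c"
proof
  fix u show "low v (b \<otimes>\<^sub>T c) u = (b \<otimes>\<^sub>T low v c + low v b \<otimes>\<^sub>T Kinv v c) u"
  proof (induction u arbitrary: b)
    case (Cons x u)
    let ?b = "\<lambda>y w. b (y # w)"
    have split: "(\<lambda>w. (b \<otimes>\<^sub>T c) (y # w)) = smul (b []) (\<lambda>w. c (y # w)) + ?b y \<otimes>\<^sub>T c" for y
      by (rule ext) (simp add: tensor_Cons smul_def)
    have lowb: "(\<lambda>w. low v b (x # w))
        = smul (if x = -1 then 1 else 0) (Kinv v (?b 1)) + low v (?b x)"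
      by (rule ext) (simp add: smul_def)
    have "((\<lambda>w. low v b (x # w)) \<otimes>\<^sub>T Kinv v c) u
        = (if x = -1 then (Kinv v (?b 1) \<otimes>\<^sub>T Kinv v c) u else 0) + (low v (?b x) \<otimes>\<^sub>T Kinv v c) u"
      by (simp only: lowb) (simp add: tensor_add_left tensor_smul_left, simp add: smul_def)
    moreover have "Kinv v (?b 1 \<otimes>\<^sub>T c) u = (Kinv v (?b 1) \<otimes>\<^sub>T Kinv v c) u"
      by (simp add: Kinv_tensor[OF assms])
    moreover have "Kinv v (smul (b []) (\<lambda>w. c (1 # w)) + ?b 1 \<otimes>\<^sub>T c) u
        = b [] * Kinv v (\<lambda>w. c (1 # w)) u + Kinv v (?b 1 \<otimes>\<^sub>T c) u"
      by (simp add: Kinv_def smul_def algebra_simps)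
    ultimately show ?case
      by (simp add: low.simps(2)[of v "b \<otimes>\<^sub>T c"] low.simps(2)[of v c] split low_smul_add Cons
          tensor_Cons[of b "low v c"] tensor_Cons[of "low v b"] del: low.simps(2))
         (simp add: algebra_simps)
  qed (simp add: tensor_Nil)
qed

lemma Kinv_weight: "has_weight b i \<Longrightarrow> Kinv v b = smul (v powi (- i)) b"
  by (rule ext) (auto simp: Kinv_def smul_def has_weight_def)

lemma has_weight_yvec: "has_weight (yvec i) i"
  by (auto simp: has_weight_def yvec_def)

lemma Kinv_yvec: "Kinv v (yvec i) = smul (v powi (- i)) (yvec i)"
  by (intro Kinv_weight has_weight_yvec)

lemma Psi_tensor_factor:
  "a \<otimes>\<^sub>T Psi v b = a \<otimes>\<^sub>T yvec 1 \<otimes>\<^sub>T b \<otimes>\<^sub>T yvec (-1)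
     - smul v (a \<otimes>\<^sub>T yvec (-1) \<otimes>\<^sub>T b \<otimes>\<^sub>T yvec 1)"
  by (simp add: Psi_def tensor_diff_right tensor_smul_right)

text \<open>
  Links are annihilated: both \<open>y\<^sub>1 \<otimes> b \<otimes> y\<^bsub>-1\<^esub>\<close> and \<open>v y\<^bsub>-1\<^esub> \<otimes> b \<otimes> y\<^sub>1\<close> are sent to
  \<open>v y\<^bsub>-1\<^esub> \<otimes> b \<otimes> y\<^bsub>-1\<^esub>\<close>, the first one because \<open>K\<inverse>\<close> scales \<open>y\<^bsub>-1\<^esub>\<close> by \<open>v\<close>.
\<close>

lemma low_Psi:
  assumes "v \<noteq> 0" "has_weight b 0" "low v b = 0"
  shows "low v (Psi v b) = 0"
proof -
  have k: "Kinv v b = b" and k1: "Kinv v (yvec 1) = smul (inverse v) (yvec 1)"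
    and km: "Kinv v (yvec (-1)) = smul v (yvec (-1))"
    using Kinv_weight[OF assms(2), of v]
    by (simp_all add: Kinv_yvec smul_def power_int_minus)
  show ?thesis
    by (simp add: Psi_def low_diff low_smul low_tensor[OF assms(1)] Kinv_tensor[OF assms(1)]
        low_yvec assms(3) k k1 km smul_zero tensor_zero_left tensor_zero_right tensor_smul_left tensor_smul_right)
qed

section \<open>One-factors and their defects\<close>

lemma one_factor_Nil: "one_factor []"
  by (simp add: one_factor_def)

lemma one_factor_take: "one_factor \<alpha> \<Longrightarrow> 0 \<le> sum_list (take i \<alpha>)"
  by (cases "i \<le> length \<alpha>") (use one_factor_def in \<open>force+\<close>)

lemma one_factor_sum: "one_factor \<alpha> \<Longrightarrow> 0 \<le> sum_list \<alpha>"
  using one_factor_take[of \<alpha> "length \<alpha>"] by simp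

lemma one_factorI:
  "set \<alpha> \<subseteq> {1, -1} \<Longrightarrow> (\<And>i. 0 \<le> sum_list (take i \<alpha>)) \<Longrightarrow> one_factor \<alpha>"
  by (simp add: one_factor_def)

lemma one_factor_set: "one_factor \<alpha> \<Longrightarrow> set \<alpha> \<subseteq> {1, -1}"
  by (simp add: one_factor_def)

lemma one_factor_append: "one_factor \<beta> \<Longrightarrow> one_factor \<gamma> \<Longrightarrow> one_factor (\<beta> @ \<gamma>)"
  by (rule one_factorI) (use one_factor_set one_factor_take in \<open>auto simp: add_nonneg_nonneg\<close>)

lemma one_factor_Cons: "one_factor \<gamma> \<Longrightarrow> one_factor (1 # \<gamma>)"
  by (rule one_factorI) (use one_factor_set one_factor_take in \<open>auto simp: take_Cons split: nat.splits intro: add_nonneg_nonneg\<close>)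

lemma one_factor_single: "one_factor [1]"
  using one_factor_Cons one_factor_Nil by simp

lemma one_factor_link:
  assumes "one_factor B"
  shows "one_factor (1 # B @ [-1])"
proof (rule one_factorI)
  fix i
  show "0 \<le> sum_list (take i (1 # B @ [-1]))"
  proof (cases i)
    case (Suc k)
    have "-1 \<le> sum_list (take (k - length B) [-1 :: int])"
      by (cases "k - length B") simp_all
    then show ?thesis
      using one_factor_take[OF assms, of k] Suc by simp
  qed simp
qed (use one_factor_set[OF assms] in auto)

lemma one_factor_snoc_minus:
  assumes "one_factor \<alpha>" "0 < sum_list \<alpha>"
  shows "one_factor (\<alpha> @ [-1])"
proof (rule one_factorI)
  fix i
  show "0 \<le> sum_list (take i (\<alpha> @ [-1]))"
    using one_factor_take[OF assms(1), of i] assms(2)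
    by (cases "i - length \<alpha>") simp_all
qed (use one_factor_set[OF assms(1)] in auto)

text \<open>
  This recursion is the one by which \<open>\<eta>\<close> is defined: the first entry is a defect, or it is paired
  with the entry at which the partial sums return to \<open>0\<close> for the first time.
\<close>

lemma one_factor_induct [consumes 1, case_names Nil defect link]:
  assumes "one_factor \<alpha>"
    and "P []"
    and defect: "\<And>\<gamma>. one_factor \<gamma> \<Longrightarrow> P \<gamma> \<Longrightarrow> P (1 # \<gamma>)"
    and link: "\<And>B \<gamma>. one_factor B \<Longrightarrow> sum_list B = 0 \<Longrightarrow> P B \<Longrightarrow> one_factor \<gamma> \<Longrightarrow> P \<gamma>
                 \<Longrightarrow> P (1 # B @ -1 # \<gamma>)"
  shows "P \<alpha>"
  using assms(1)
proof (induction \<alpha> rule: length_induct)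
  case (1 \<alpha>)
  show ?case
  proof (cases \<alpha>)
    case Nil
    then show ?thesis using assms(2) by simp
  next
    case (Cons a as)
    have nonneg: "0 \<le> a + sum_list (take k as)" for k
      using one_factor_take[OF 1(2), of "Suc k"] Cons by simp
    have a: "a = 1"
      using nonneg[of 0] one_factor_set[OF 1(2)] Cons by auto
    have as: "set as \<subseteq> {1, -1}"
      using one_factor_set[OF 1(2)] Cons by simp
    show ?thesis
    proof (cases "\<exists>k. sum_list (take k as) = -1")
      case False
      have "one_factor as"
        by (rule one_factorI[OF as]) (use nonneg a False in \<open>smt (verit)\<close>)
      then show ?thesis
        using defect 1(1) Cons a by simp
    next
      case True
      \<comment> \<open>The leading \<open>1\<close> is stripped, so returning to height \<open>0\<close> means partial sum \<open>-1\<close> in \<open>as\<close>.\<close>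
      define k where "k = (LEAST k. sum_list (take k as) = -1)"
      have k: "sum_list (take k as) = -1"
        unfolding k_def using True by (rule LeastI_ex)
      have min: "sum_list (take i as) \<noteq> -1" if "i < k" for i
        using not_less_Least[of i] that unfolding k_def by blast
      from k obtain p where p: "k = Suc p" by (cases k) auto
      have len: "p < length as"
      proof (rule ccontr)
        assume "\<not> p < length as"
        then have "take p as = take k as" using p by simp
        then show False using min[of p] k p by simp
      qed
      let ?B = "take p as"
      have B: "one_factor ?B"
      proof (rule one_factorI)
        fix i
        have "sum_list (take (min i p) as) \<noteq> -1" by (rule min) (simp add: p)
        then show "0 \<le> sum_list (take i ?B)"
          using nonneg[of "min i p"] a by simp
      qed (use as set_take_subset in fast)
      have tk: "take k as = ?B @ [as ! p]"
        using len p by (simp add: take_Suc_conv_app_nth)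
      have "as ! p = 1 \<or> as ! p = -1"
        using as len nth_mem by blast
      then have ap: "as ! p = -1" and B0: "sum_list ?B = 0"
        using one_factor_sum[OF B] k tk by auto
      have \<gamma>: "one_factor (drop k as)"
      proof (rule one_factorI)
        fix i
        show "0 \<le> sum_list (take i (drop k as))"
          using nonneg[of "k + i"] k a by (simp add: take_add)
      qed (use as set_drop_subset in fast)
      have eq: "\<alpha> = 1 # ?B @ -1 # drop k as"
        using Cons a len ap p id_take_nth_drop[OF len] by simp
      have "length ?B < length \<alpha>" "length (drop k as) < length \<alpha>"
        using Cons by auto
      then have "P (1 # ?B @ -1 # drop k as)"
        using link[OF B B0 _ \<gamma>] 1(1) B \<gamma> by blast
      then show ?thesis using eq by simp
    qed
  qed
qed

text \<open>
  The induction on the number of defects removes the last defect and not the first one: \<open>\<Phi>\<^sub>2\<close>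
  adds its new factor on the right, and the scalar \<open>[j]\<close> in the sum counts defects from the left,
  so that it is not changed by cutting off the right end.
\<close>

lemma last_defect_decomposition:
  assumes "one_factor \<alpha>" "sum_list \<alpha> > 0"
  obtains \<beta> B where "\<alpha> = \<beta> @ 1 # B" "one_factor \<beta>" "one_factor B" "sum_list B = 0"
proof -
  have "sum_list \<alpha> > 0 \<longrightarrow>
      (\<exists>\<beta> B. \<alpha> = \<beta> @ 1 # B \<and> one_factor \<beta> \<and> one_factor B \<and> sum_list B = 0)"
    using assms(1)
  proof (induction rule: one_factor_induct)
    case (defect \<gamma>)
    show ?case
    proof (cases "sum_list \<gamma> = 0")
      case True
      then show ?thesis using defect one_factor_Nil by blast
    next
      case False
      then obtain \<beta> B where "\<gamma> = \<beta> @ 1 # B" "one_factor \<beta>" "one_factor B" "sum_list B = 0"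
        using defect one_factor_sum[of \<gamma>] by auto
      then show ?thesis
        using one_factor_Cons by (metis append_Cons)
    qed
  next
    case (link B' \<gamma>)
    show ?case
    proof
      assume "0 < sum_list (1 # B' @ - 1 # \<gamma>)"
      then obtain \<beta> B where "\<gamma> = \<beta> @ 1 # B" "one_factor \<beta>" "one_factor B" "sum_list B = 0"
        using link by auto
      moreover have "one_factor ((1 # B' @ [-1]) @ \<beta>)"
        using one_factor_append one_factor_link link calculation by blast
      ultimately show "\<exists>\<beta> B. 1 # B' @ - 1 # \<gamma> = \<beta> @ 1 # B \<and> one_factor \<beta> \<and> one_factor B
          \<and> sum_list B = 0"
        by (intro exI[of _ "(1 # B' @ [-1]) @ \<beta>"] exI[of _ B]) simp
    qed
  qed simp
  then show thesis using assms(2) that by blast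
qed

text \<open>
  Heights of prefixes in place of sums over segments: they behave well under concatenation.
\<close>

lemma pairing_iff:
  "pairing \<alpha> i j \<longleftrightarrow> i < j \<and> j < length \<alpha> \<and> \<alpha> ! i = 1
     \<and> sum_list (take (Suc j) \<alpha>) = sum_list (take i \<alpha>)
     \<and> (\<forall>k. i < k \<and> k < j \<longrightarrow> sum_list (take (Suc k) \<alpha>) \<noteq> sum_list (take i \<alpha>))"
proof -
  have seg: "(\<Sum>t=i..k. \<alpha> ! t) = sum_list (take (Suc k) \<alpha>) - sum_list (take i \<alpha>)"
    if "i \<le> k" "k < length \<alpha>" for k
    using that
  proof (induction k rule: dec_induct)
    case (step k)
    then show ?case by (simp add: take_Suc_conv_app_nth)
  qed (simp add: take_Suc_conv_app_nth)
  show ?thesis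
    unfolding pairing_def using seg by auto
qed

text \<open>
  Between the two ends of a pair the path stays strictly above its starting height, by
  discrete continuity: the steps are \<open>\<plusminus>1\<close>, and the starting height is not met in between.
\<close>

lemma pairing_above:
  assumes "set \<alpha> \<subseteq> {1, -1}" "pairing \<alpha> i j" "i < k" "k \<le> j"
  shows "sum_list (take i \<alpha>) < sum_list (take k \<alpha>)"
proof -
  have "Suc i \<le> k" using assms(3) by simp
  then show ?thesis
    using assms(4)
  proof (induction k rule: dec_induct)
    case base
    then show ?case
      using assms(2) by (simp add: pairing_iff take_Suc_conv_app_nth)
  next
    case (step k)
    then have "k < length \<alpha>" "sum_list (take (Suc k) \<alpha>) \<noteq> sum_list (take i \<alpha>)"
      using assms(2) by (auto simp: pairing_iff)
    moreover from this have "\<alpha> ! k = 1 \<or> \<alpha> ! k = -1"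
      using assms(1) nth_mem by blast
    ultimately show ?case
      using step by (auto simp: take_Suc_conv_app_nth)
  qed
qed

lemma pairing_unique: "pairing \<alpha> i j \<Longrightarrow> pairing \<alpha> i j' \<Longrightarrow> j = j'"
  unfolding pairing_def by (metis linorder_neqE_nat)

lemma pairing_append_right:
  "pairing (\<beta> @ \<gamma>) (length \<beta> + i) (length \<beta> + j) \<longleftrightarrow> pairing \<gamma> i j"
proof -
  have shift: "(\<forall>k. length \<beta> + i < k \<and> k < length \<beta> + j \<longrightarrow> Q k)
      \<longleftrightarrow> (\<forall>k. i < k \<and> k < j \<longrightarrow> Q (length \<beta> + k))" for Q
  proof (intro iffI allI impI)
    fix k assume *: "\<forall>k. i < k \<and> k < j \<longrightarrow> Q (length \<beta> + k)"
      and k: "length \<beta> + i < k \<and> k < length \<beta> + j"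
    have "i < k - length \<beta> \<and> k - length \<beta> < j" using k by linarith
    then have "Q (length \<beta> + (k - length \<beta>))" using * by blast
    then show "Q k" using k by simp
  qed simp
  show ?thesis
    unfolding pairing_iff shift by (simp add: nth_append)
qed

lemma pairing_append_left:
  "j < length \<beta> \<Longrightarrow> pairing (\<beta> @ \<gamma>) i j \<longleftrightarrow> pairing \<beta> i j"
  by (auto simp: pairing_iff nth_append)

text \<open>
  Where the two parts meet, the path of a straddling pair would be strictly above its
  starting height, and a \<open>1\<close>-factor on the right never goes below the height at the meeting point.
\<close>

lemma no_pairing_across:
  assumes "set \<beta> \<subseteq> {1, -1}" "one_factor \<gamma>" "i < length \<beta>" "length \<beta> \<le> j"
  shows "\<not> pairing (\<beta> @ \<gamma>) i j"
proof
  assume p: "pairing (\<beta> @ \<gamma>) i j"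
  have "sum_list (take i (\<beta> @ \<gamma>)) < sum_list (take (length \<beta>) (\<beta> @ \<gamma>))"
    using assms one_factor_set by (intro pairing_above[OF _ p]) auto
  moreover have "0 \<le> sum_list (take (Suc j - length \<beta>) \<gamma>)"
    using one_factor_take[OF assms(2)] .
  ultimately show False
    using p assms(3,4) by (simp add: pairing_iff)
qed

lemma pairing_link:
  assumes "one_factor B" "sum_list B = 0"
  shows "pairing (1 # B @ -1 # \<gamma>) 0 (Suc (length B))"
proof -
  have "1 + sum_list (take k B) \<noteq> 0" for k
    using one_factor_take[OF assms(1), of k] by simp
  then show ?thesis
    using assms(2) by (auto simp: pairing_iff)
qed

definition defect_set :: "int list \<Rightarrow> nat set" where
  "defect_set \<alpha> = {i. i < length \<alpha> \<and> (\<forall>j. \<not> pairing \<alpha> i j \<and> \<not> pairing \<alpha> j i)}"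

lemma finite_defect_set: "finite (defect_set \<alpha>)"
  by (simp add: defect_set_def)

lemma defect_set_append:
  assumes "set \<beta> \<subseteq> {1, -1}" "one_factor \<gamma>"
  shows "defect_set (\<beta> @ \<gamma>) = defect_set \<beta> \<union> (+) (length \<beta>) ` defect_set \<gamma>"
proof -
  let ?l = "length \<beta>"
  note across = no_pairing_across[OF assms]
  have lt: "pairing \<alpha> i j \<Longrightarrow> i < j \<and> j < length \<alpha>" for \<alpha> i j
    by (simp add: pairing_def)
  have left: "i \<in> defect_set (\<beta> @ \<gamma>) \<longleftrightarrow> i \<in> defect_set \<beta>" if "i < ?l" for i
  proof -
    have "pairing (\<beta> @ \<gamma>) i j \<longleftrightarrow> pairing \<beta> i j" for j
      using across[OF that, of j] lt[of \<beta> i j] pairing_append_left[of j \<beta> \<gamma> i]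
      by (cases "j < ?l") auto
    then show ?thesis
      using that pairing_append_left[OF that] by (simp add: defect_set_def)
  qed
  have right: "?l + i \<in> defect_set (\<beta> @ \<gamma>) \<longleftrightarrow> i \<in> defect_set \<gamma>" for i
  proof -
    have 1: "(\<exists>j. pairing (\<beta> @ \<gamma>) (?l + i) j) \<longleftrightarrow> (\<exists>j. pairing \<gamma> i j)"
      using pairing_append_right lt by (metis le_add1 le_iff_add order.trans less_imp_le)
    have 2: "(\<exists>j. pairing (\<beta> @ \<gamma>) j (?l + i)) \<longleftrightarrow> (\<exists>j. pairing \<gamma> j i)"
      using pairing_append_right across by (metis le_add1 le_iff_add not_le)
    show ?thesis using 1 2 by (auto simp: defect_set_def)
  qed
  show ?thesis
  proof (intro set_eqI)
    fix x
    show "x \<in> defect_set (\<beta> @ \<gamma>) \<longleftrightarrow> x \<in> defect_set \<beta> \<union> (+) ?l ` defect_set \<gamma>"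
    proof (cases "x < ?l")
      case True
      then show ?thesis using left by auto
    next
      case False
      then obtain i where i: "x = ?l + i" by (metis le_iff_add not_less)
      have "x \<notin> defect_set \<beta>" using False by (simp add: defect_set_def)
      then show ?thesis unfolding i by (simp add: right image_iff)
    qed
  qed
qed

lemma defects_append:
  assumes "set \<beta> \<subseteq> {1, -1}" "one_factor \<gamma>"
  shows "defects (\<beta> @ \<gamma>) = defects \<beta> @ map ((+) (length \<beta>)) (defects \<gamma>)"
proof -
  have d: "defects \<alpha> = sorted_list_of_set (defect_set \<alpha>)" for \<alpha>
    by (simp add: defects_def defect_set_def)
  have bound: "x < length \<beta>" if "x \<in> defect_set \<beta>" for x
    using that by (simp add: defect_set_def)
  have "sorted_wrt (<) (defects \<beta> @ map ((+) (length \<beta>)) (defects \<gamma>))"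
    using bound
    by (auto simp: d sorted_wrt_append sorted_wrt_map finite_defect_set trans_less_add1)
  then show ?thesis
    by (intro strict_sorted_equal)
       (simp_all add: d finite_defect_set defect_set_append[OF assms])
qed

lemma defects_single: "defects [1] = [0]"
proof -
  have "defect_set [1] = {0}"
    by (auto simp: defect_set_def pairing_def)
  then show ?thesis by (simp add: defects_def defect_set_def)
qed

lemma defect_set_link:
  assumes "one_factor B" "sum_list B = 0" "defect_set B = {}"
  shows "defect_set (1 # B @ [-1]) = {}"
proof -
  let ?\<alpha> = "1 # B @ [-1]"
  have "\<exists>j. pairing ?\<alpha> x j \<or> pairing ?\<alpha> j x" if lt: "x < length ?\<alpha>" for x
  proof -
    consider "x = 0" | "x = Suc (length B)" | y where "x = Suc y" "y < length B"
      using lt by (cases x) (auto simp: less_Suc_eq)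
    then show ?thesis
    proof cases
      case 3
      then obtain j where j: "pairing B y j \<or> pairing B j y"
        using assms(3) by (auto simp: defect_set_def)
      have "pairing ?\<alpha> (Suc p) (Suc q)" if "pairing B p q" for p q
      proof -
        have "pairing (B @ [-1]) p q"
          using that pairing_append_left[of q B] by (metis pairing_def)
        then show ?thesis
          using pairing_append_right[of "[1]" "B @ [-1]" p q] by simp
      qed
      then show ?thesis using j 3 by blast
    qed (use pairing_link[OF assms(1,2), of "[]"] in blast)+
  qed
  then show ?thesis unfolding defect_set_def by blast
qed

text \<open>
  This makes the index of a defect a bound on partial sums, and identifies the new defect
  of \<open>\<alpha>\<^sup>+\<close> as the one following the \<open>i\<^sub>\<alpha>\<close> defects of \<open>\<alpha>\<close>.
\<close>

lemma length_defects: "one_factor \<alpha> \<Longrightarrow> int (length (defects \<alpha>)) = sum_list \<alpha>"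
proof (induction rule: one_factor_induct)
  case Nil
  then show ?case by (simp add: defects_def)
next
  case (defect \<gamma>)
  then show ?case
    using defects_append[of "[1]" \<gamma>] by (simp add: defects_single)
next
  case (link B \<gamma>)
  have "defects B = []" using link by simp
  then have "defect_set B = {}"
    using finite_defect_set[of B] by (simp add: defects_def defect_set_def)
  then have "defects (1 # B @ [-1]) = []"
    using defect_set_link link by (simp add: defects_def defect_set_def)
  then show ?case
    using defects_append[of "1 # B @ [-1]" \<gamma>] one_factor_set[OF link(1)] link by auto
qed

text \<open>
  Defects are numbered from the left, so one of \<open>\<beta>\<close> keeps its number and its position. The
  assumption on \<open>j\<close> says that the \<open>(j+1)\<close>st defect lies in \<open>\<beta>\<close>.
\<close>

lemma pair_defect_append:
  assumes "one_factor \<beta>" "one_factor \<gamma>" "int j < sum_list \<beta>"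
  shows "pair_defect j (\<beta> @ \<gamma>) = pair_defect j \<beta> @ \<gamma>"
proof -
  have j: "j < length (defects \<beta>)"
    using length_defects[OF assms(1)] assms(3) by simp
  have "defects \<beta> ! j \<in> defect_set \<beta>"
    using nth_mem[OF j] finite_defect_set[of \<beta>] by (simp add: defects_def defect_set_def)
  then have "defects \<beta> ! j < length \<beta>"
    by (simp add: defect_set_def)
  then show ?thesis
    using j by (simp add: pair_defect_def defects_append[OF one_factor_set[OF assms(1)] assms(2)]
        nth_append list_update_append1)
qed

lemma pair_defect_last:
  assumes "one_factor \<alpha>" "int d = sum_list \<alpha>"
  shows "pair_defect d (\<alpha> @ [1]) = \<alpha> @ [-1]"
proof -
  have "length (defects \<alpha>) = d"
    using length_defects[OF assms(1)] assms(2) by simp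
  then show ?thesis
    by (simp add: pair_defect_def nth_append defects_single
        defects_append[OF one_factor_set[OF assms(1)] one_factor_single])
qed

text \<open>
  Needed to apply \<open>eta_append\<close> to \<open>\<alpha>\<^bsup>+(j)\<^esup>\<close>. If \<open>j\<close> is the number of defects, the appended entry becomes
  \<open>-1\<close>, which is harmless at positive height; otherwise the changed entry lies in the prefix \<open>\<beta>\<^sup>+\<close> of \<open>\<alpha>\<close>
  that ends with its last defect, and the induction hypothesis applies to \<open>\<beta>\<close>.
\<close>

lemma one_factor_pair_defect:
  assumes "one_factor \<alpha>" "1 \<le> j" "int j \<le> sum_list \<alpha>"
  shows "one_factor (pair_defect j (\<alpha> @ [1]))"
  using assms
proof (induction "length \<alpha>" arbitrary: \<alpha> rule: less_induct)
  case less
  show ?case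
  proof (cases "int j = sum_list \<alpha>")
    case True
    then show ?thesis
      using pair_defect_last one_factor_snoc_minus less.prems by simp
  next
    case False
    obtain \<beta> B where dec: "\<alpha> = \<beta> @ 1 # B" "one_factor \<beta>" "one_factor B" "sum_list B = 0"
      using last_defect_decomposition[OF less.prems(1)] less.prems by auto
    have B1: "one_factor (B @ [1])"
      using dec one_factor_append one_factor_single by blast
    have "pair_defect j ((\<beta> @ [1]) @ (B @ [1])) = pair_defect j (\<beta> @ [1]) @ (B @ [1])"
      using dec False less.prems B1
      by (intro pair_defect_append one_factor_append one_factor_single) auto
    moreover have "one_factor (pair_defect j (\<beta> @ [1]))"
      using less.hyps[of \<beta>] dec False less.prems by auto
    ultimately show ?thesis
      using B1 one_factor_append dec(1) by simp
  qed
qed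

section \<open>The vectors of one-factors\<close>

(* The second equation calls eta again under a condition on pairings that the simplifier cannot
   decide, so it would be unfolded without end. *)
declare eta.simps(2) [simp del]

lemma eta_link:
  assumes "one_factor B" "sum_list B = 0"
  shows "eta v (1 # B @ -1 # \<gamma>) = Psi v (eta v B) \<otimes>\<^sub>T eta v \<gamma>"
proof -
  note p = pairing_link[OF assms, of \<gamma>]
  have the: "(THE j. pairing (1 # B @ -1 # \<gamma>) 0 j) = Suc (length B)"
    using p pairing_unique by blast
  have ex: "\<exists>j. pairing (1 # B @ -1 # \<gamma>) 0 j"
    using p by blast
  show ?thesis
    by (subst eta.simps(2)) (simp only: if_P[OF ex] the Let_def, simp)
qed

lemma eta_defect:
  assumes "one_factor \<gamma>"
  shows "eta v (1 # \<gamma>) = yvec 1 \<otimes>\<^sub>T eta v \<gamma>"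
proof -
  have "\<not> pairing (1 # \<gamma>) 0 j" for j
    using no_pairing_across[of "[1]" \<gamma> 0 j] assms by (cases "1 \<le> j") (auto simp: pairing_def)
  then have "\<not> (\<exists>j. pairing (1 # \<gamma>) 0 j)"
    by blast
  then show ?thesis
    by (subst eta.simps(2)) (simp only: if_False)
qed

text \<open>
  Induction along the recursion for \<open>\<eta>\<close>. Whether the first entry of \<open>\<beta>\<close> is a defect is decided inside
  \<open>\<beta>\<close>, since \<open>\<gamma>\<close> never goes below its starting height.
\<close>

lemma eta_append:
  assumes "one_factor \<beta>" "one_factor \<gamma>"
  shows "eta v (\<beta> @ \<gamma>) = eta v \<beta> \<otimes>\<^sub>T eta v \<gamma>"
  using assms(1)
proof (induction rule: one_factor_induct)
  case Nil
  then show ?case by (simp add: tens_one_left)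
next
  case (defect \<beta>)
  have "eta v (1 # (\<beta> @ \<gamma>)) = yvec 1 \<otimes>\<^sub>T eta v (\<beta> @ \<gamma>)"
    by (intro eta_defect one_factor_append defect assms)
  then show ?case
    using defect by (simp add: eta_defect tensor_assoc)
next
  case (link B \<beta>)
  then show ?case
    using eta_link[of B v "\<beta> @ \<gamma>"] by (simp add: eta_link tensor_assoc)
qed

lemma eta_single: "eta v [1] = yvec 1"
  using eta_defect[OF one_factor_Nil] by (simp add: tens_one_right)

lemma eta_arc:
  assumes "one_factor B" "sum_list B = 0"
  shows "eta v (1 # B @ [-1]) = Psi v (eta v B)"
  using eta_link[OF assms, of v "[]"] by (simp add: tens_one_right)

lemma Psi_support:
  assumes "Psi v b w \<noteq> 0"
  obtains u where "b u \<noteq> 0" "w = 1 # u @ [-1] \<or> w = -1 # u @ [1]"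
proof -
  have y: "\<exists>u. b u \<noteq> 0 \<and> w = i # u @ [j]" if "(yvec i \<otimes>\<^sub>T b \<otimes>\<^sub>T yvec j) w \<noteq> 0" for i j
    using that by (elim tensor_support) (auto simp: yvec_def split: if_splits)
  have "(yvec 1 \<otimes>\<^sub>T b \<otimes>\<^sub>T yvec (-1)) w \<noteq> 0 \<or> (yvec (-1) \<otimes>\<^sub>T b \<otimes>\<^sub>T yvec 1) w \<noteq> 0"
    using assms by (auto simp: Psi_def smul_def)
  then show thesis using y that by metis
qed

lemma eta_support:
  assumes "one_factor \<alpha>" "eta v \<alpha> w \<noteq> 0"
  shows "w \<in> words (length \<alpha>) \<and> sum_list w = sum_list \<alpha>"
  using assms
proof (induction arbitrary: w rule: one_factor_induct)
  case Nil
  then show ?case by (simp add: tens_one_def words_def split: if_splits)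
next
  case (defect \<gamma>)
  then obtain u u' where "w = u @ u'" "yvec 1 u \<noteq> (0::'a)" "eta v \<gamma> u' \<noteq> 0"
    by (auto simp: eta_defect elim: tensor_support)
  then show ?case
    using defect by (auto simp: yvec_def words_def split: if_splits)
next
  case (link B \<gamma>)
  then obtain u u' where "w = u @ u'" "Psi v (eta v B) u \<noteq> 0" "eta v \<gamma> u' \<noteq> 0"
    by (auto simp: eta_link elim: tensor_support)
  moreover from this(2) obtain t where "eta v B t \<noteq> 0" "u = 1 # t @ [-1] \<or> u = -1 # t @ [1]"
    by (rule Psi_support)
  ultimately show ?case
    using link.IH(1)[of t] link.IH(2)[of u'] link.hyps by (auto simp: words_def)
qed

lemma eta_weight: "one_factor \<alpha> \<Longrightarrow> has_weight (eta v \<alpha>) (sum_list \<alpha>)"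
  unfolding has_weight_def using eta_support by blast

text \<open>
  Each link contributes its term \<open>y\<^sub>1 \<otimes> b \<otimes> y\<^bsub>-1\<^esub>\<close>, with coefficient \<open>1\<close>, to the word \<open>\<alpha>\<close>. Hence
  \<open>\<eta>(\<alpha>)\<close> is nonzero and its weight is well defined.
\<close>

lemma eta_leading_coefficient: "one_factor \<alpha> \<Longrightarrow> eta v \<alpha> \<alpha> = 1"
proof (induction rule: one_factor_induct)
  case Nil
  then show ?case by (simp add: tens_one_def)
next
  case (defect \<gamma>)
  have "(yvec 1 \<otimes>\<^sub>T eta v \<gamma>) (1 # \<gamma>) = yvec 1 [1] * eta v \<gamma> \<gamma>"
    by (rule tensor_singletons_Cons) (auto simp: yvec_def split: if_splits)
  then show ?case
    using defect by (simp add: eta_defect yvec_def)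
next
  case (link B \<gamma>)
  have len: "length u = length B" if "eta v B u \<noteq> 0" for u
    using eta_support[OF link(1) that] by (simp add: words_def)
  have "length u = length (1 # B @ [-1])" if "Psi v (eta v B) u \<noteq> 0" for u
    using that len by (elim Psi_support) fastforce
  from tensor_append[OF this, of "Psi v (eta v B)" "eta v \<gamma>" \<gamma>]
  have 1: "eta v (1 # B @ -1 # \<gamma>) (1 # B @ -1 # \<gamma>) = Psi v (eta v B) (1 # B @ [-1])"
    using link by (simp add: eta_link)
  have y: "(yvec i \<otimes>\<^sub>T c) (1 # w) = yvec i [1] * c w" for i w and c :: "'a tens"
    by (rule tensor_singletons_Cons) (auto simp: yvec_def split: if_splits)
  have "(eta v B \<otimes>\<^sub>T yvec (-1)) (B @ [-1]) = eta v B B * yvec (-1) [-1]"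
    by (rule tensor_append) (rule len)
  then have "Psi v (eta v B) (1 # B @ [-1]) = 1"
    using link by (simp add: Psi_def smul_def y) (simp add: yvec_def)
  then show ?case using 1 by simp
qed

lemma weight_eta:
  assumes "one_factor \<alpha>"
  shows "weight (eta v \<alpha>) = sum_list \<alpha>"
  unfolding weight_def
proof (rule the_equality)
  fix i assume "has_weight (eta v \<alpha>) i"
  then show "i = sum_list \<alpha>"
    using eta_leading_coefficient[OF assms, of v] unfolding has_weight_def
    by (metis zero_neq_one)
qed (rule eta_weight[OF assms])

lemma low_eta_balanced:
  assumes "v \<noteq> 0" "one_factor B" "sum_list B = 0"
  shows "low v (eta v B) = 0"
proof -
  have "sum_list B = 0 \<longrightarrow> low v (eta v B) = 0"
    using assms(2)
  proof (induction rule: one_factor_induct)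
    case Nil
    then show ?case by (simp add: low_tens_one)
  next
    case (defect \<gamma>)
    then show ?case using one_factor_sum[of \<gamma>] by simp
  next
    case (link B \<gamma>)
    have "low v (Psi v (eta v B)) = 0"
    proof (rule low_Psi[OF assms(1)])
      show "has_weight (eta v B) 0"
        using eta_weight[OF link(1), of v] link(2) by simp
      show "low v (eta v B) = 0"
        using link.IH(1) link(2) by blast
    qed
    then have "low v (eta v (1 # B @ -1 # \<gamma>)) = Psi v (eta v B) \<otimes>\<^sub>T low v (eta v \<gamma>)"
      by (simp only: eta_link[OF link(1,2)] low_tensor[OF assms(1)] tensor_zero_left add_0_right)
    moreover have "sum_list (1 # B @ -1 # \<gamma>) = sum_list \<gamma>"
      using link(2) by simp
    ultimately show ?case
      using link.IH(2) tensor_zero_right by metis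
  qed
  then show ?thesis using assms(3) by simp
qed

lemma Phi2_eta:
  assumes "v \<noteq> 0" "one_factor \<alpha>"
  shows "Phi2 v (eta v \<alpha>) = smul (qint v (sum_list \<alpha>)) (eta v \<alpha> \<otimes>\<^sub>T yvec (-1))
           - smul (v powi sum_list \<alpha>) (low v (eta v \<alpha>) \<otimes>\<^sub>T yvec 1)"
proof -
  have "F_op v (eta v \<alpha>) = low v (eta v \<alpha>)"
    using eta_support[OF assms(2)] by (intro F_op_eq_low assms(1)) (auto simp: words_def)
  then show ?thesis
    by (simp add: Phi2_def weight_eta[OF assms(2)])
qed

lemma qint_Suc:
  assumes "v \<noteq> 0"
  shows "v * qint v (int (Suc k)) = qint v (int k) + v powi (int k + 1)"
proof -
  have "qint v (int (Suc k)) = (\<Sum>t<Suc k. v powi (int k - 2 * int t))"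
    unfolding qint_def nat_int by simp
  then have "v * qint v (int (Suc k)) = (\<Sum>t<Suc k. v * v powi (int k - 2 * int t))"
    by (simp only: sum_distrib_left)
  also have "\<dots> = (\<Sum>t<Suc k. v powi (int k + 1 - 2 * int t))"
  proof (intro sum.cong refl)
    fix t
    show "v * v powi (int k - 2 * int t) = v powi (int k + 1 - 2 * int t)"
      using power_int_add_1[of v "int k - 2 * int t"] assms by (simp add: algebra_simps)
  qed
  also have "\<dots> = v powi (int k + 1) + (\<Sum>t<k. v powi (int k - 1 - 2 * int t))"
    by (subst sum.lessThan_Suc_shift) (simp add: algebra_simps)
  finally show ?thesis by (simp add: qint_def)
qed

text \<open>
  The recursion for \<open>\<Phi>\<^sub>2\<close> when the last defect is removed. The terms containing \<open>F \<eta>(\<beta>)\<close> on the two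
  sides agree because the factor \<open>v\<inverse>\<close>, with which \<open>K\<inverse>\<close> acts on the split-off \<open>y\<^sub>1\<close>, lowers the exponent
  in \<open>v\<^bsup>i\<^esup>\<close> to the weight of \<open>\<eta>(\<beta>)\<close>.
\<close>

lemma Phi2_eta_last_defect:
  assumes "v \<noteq> 0" "one_factor \<beta>" "one_factor B" "sum_list B = 0"
  shows "Phi2 v (eta v (\<beta> @ 1 # B))
       = smul (qint v (sum_list \<beta> + 1)) (eta v (\<beta> @ 1 # B @ [-1]))
         + Phi2 v (eta v \<beta>) \<otimes>\<^sub>T eta v (B @ [1])"
proof -
  define k where "k = nat (sum_list \<beta>)"
  have k: "sum_list \<beta> = int k"
    using one_factor_sum[OF assms(2)] by (simp add: k_def)
  let ?a = "eta v \<beta>" and ?e = "eta v B" and ?y = "yvec 1" and ?z = "yvec (-1)"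
  have of1: "one_factor (\<beta> @ 1 # B)"
    by (intro one_factor_append one_factor_Cons assms)
  have eta1: "eta v (\<beta> @ 1 # B) = ?a \<otimes>\<^sub>T ?y \<otimes>\<^sub>T ?e"
    using eta_append[OF assms(2) one_factor_Cons[OF assms(3)], of v] eta_defect[OF assms(3), of v]
    by simp
  have eta2: "eta v (\<beta> @ 1 # B @ [-1])
      = ?a \<otimes>\<^sub>T ?y \<otimes>\<^sub>T ?e \<otimes>\<^sub>T ?z - smul v (?a \<otimes>\<^sub>T ?z \<otimes>\<^sub>T ?e \<otimes>\<^sub>T ?y)"
    using eta_append[OF assms(2) one_factor_link[OF assms(3)], of v] eta_arc[OF assms(3,4), of v]
    by (simp add: Psi_tensor_factor)
  have eta3: "eta v (B @ [1]) = ?e \<otimes>\<^sub>T ?y"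
    using eta_append[OF assms(3) one_factor_single, of v] eta_single[of v] by simp
  have Ke: "Kinv v ?e = ?e" and Ky: "Kinv v ?y = smul (inverse v) ?y"
    using Kinv_weight[OF eta_weight[OF assms(3), of v], of v] assms(4)
    by (simp_all add: Kinv_yvec smul_def power_int_minus)
  have low: "low v (?a \<otimes>\<^sub>T ?y \<otimes>\<^sub>T ?e)
      = ?a \<otimes>\<^sub>T ?z \<otimes>\<^sub>T ?e + smul (inverse v) (low v ?a \<otimes>\<^sub>T ?y \<otimes>\<^sub>T ?e)"
    using low_eta_balanced[OF assms(1,3,4)]
    by (simp add: low_tensor[OF assms(1)] Kinv_tensor[OF assms(1)] low_yvec Ke Ky
        tensor_zero_right tensor_smul_left tensor_smul_right)
  show ?thesis
  proof
    fix w
    let ?X = "(?a \<otimes>\<^sub>T ?y \<otimes>\<^sub>T ?e \<otimes>\<^sub>T ?z) w" and ?Y = "(?a \<otimes>\<^sub>T ?z \<otimes>\<^sub>T ?e \<otimes>\<^sub>T ?y) w"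
      and ?Z = "(low v ?a \<otimes>\<^sub>T ?y \<otimes>\<^sub>T ?e \<otimes>\<^sub>T ?y) w"
    have "Phi2 v (eta v (\<beta> @ 1 # B)) w
        = qint v (int (Suc k)) * ?X - v powi (int k + 1) * (?Y + inverse v * ?Z)"
      unfolding Phi2_eta[OF assms(1) of1] unfolding eta1 low
      by (simp add: k assms(4) tensor_assoc tensor_add_left tensor_smul_left, simp add: smul_def add.commute)
    also have "\<dots> = qint v (int (Suc k)) * ?X
        - (v * qint v (int (Suc k)) - qint v (int k)) * ?Y - v powi int k * ?Z"
      unfolding qint_Suc[OF assms(1)] using assms(1) by (simp add: power_int_add field_simps)
    also have "\<dots> = (smul (qint v (sum_list \<beta> + 1)) (eta v (\<beta> @ 1 # B @ [-1]))
         + Phi2 v (eta v \<beta>) \<otimes>\<^sub>T eta v (B @ [1])) w"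
      unfolding Phi2_eta[OF assms(1,2)] unfolding eta2 eta3
      by (simp add: k tensor_assoc tensor_diff_left tensor_smul_left, simp add: smul_def algebra_simps)
    finally show "Phi2 v (eta v (\<beta> @ 1 # B)) w
      = (smul (qint v (sum_list \<beta> + 1)) (eta v (\<beta> @ 1 # B @ [-1]))
         + Phi2 v (eta v \<beta>) \<otimes>\<^sub>T eta v (B @ [1])) w" .
  qed
qed

text \<open>
  For \<open>d = 0\<close> both sides vanish, since \<open>[0] = 0\<close> and \<open>F\<close> annihilates \<open>\<eta>(\<alpha>)\<close>. In the step, the term
  \<open>j = d\<close> pairs the last defect of \<open>\<alpha>\<close> with the appended one, and the others come from \<open>\<beta>\<close>.
\<close>

lemma Phi2_eta_sum:
  assumes "v \<noteq> 0" "one_factor \<alpha>" "int d = sum_list \<alpha>"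
  shows "Phi2 v (eta v \<alpha>)
       = (\<Sum>j=1..d. smul (qint v (int j)) (eta v (pair_defect j (\<alpha> @ [1]))))"
  using assms(2,3)
proof (induction d arbitrary: \<alpha>)
  case 0
  then show ?case
    using Phi2_eta[OF assms(1) 0(1)] low_eta_balanced[OF assms(1) 0(1)]
    by (auto simp: qint_def smul_def tensor_zero_left)
next
  case (Suc d)
  obtain \<beta> B where dec: "\<alpha> = \<beta> @ 1 # B" "one_factor \<beta>" "one_factor B" "sum_list B = 0"
    using last_defect_decomposition[OF Suc(2)] Suc(3) by auto
  have d: "int d = sum_list \<beta>"
    using Suc(3) dec by simp
  have B1: "one_factor (B @ [1])"
    using dec one_factor_append one_factor_single by blast
  have last: "pair_defect (Suc d) (\<alpha> @ [1]) = \<beta> @ 1 # B @ [-1]"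
    using pair_defect_last[OF Suc(2,3)] dec by simp
  have earlier: "eta v (pair_defect j (\<alpha> @ [1]))
      = eta v (pair_defect j (\<beta> @ [1])) \<otimes>\<^sub>T eta v (B @ [1])" if "j \<in> {1..d}" for j
  proof -
    have "pair_defect j ((\<beta> @ [1]) @ (B @ [1])) = pair_defect j (\<beta> @ [1]) @ (B @ [1])"
      using dec d that B1
      by (intro pair_defect_append one_factor_append one_factor_single) auto
    moreover have "one_factor (pair_defect j (\<beta> @ [1]))"
      using one_factor_pair_defect[OF dec(2)] that d by auto
    ultimately show ?thesis
      using eta_append[OF _ B1] dec(1) by simp
  qed
  have "Phi2 v (eta v \<beta>) \<otimes>\<^sub>T eta v (B @ [1])
      = (\<Sum>j=1..d. smul (qint v (int j)) (eta v (pair_defect j (\<alpha> @ [1]))))"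
    by (simp add: Suc.IH[OF dec(2) d] tensor_sum_left tensor_smul_left earlier)
  moreover have "sum_list \<beta> + 1 = int (Suc d)"
    using d by simp
  ultimately show ?case
    using Phi2_eta_last_defect[OF assms(1) dec(2-4)] last dec(1)
    by (simp add: add.commute del: of_nat_Suc)
qed

theorem theorem4p6:
  fixes v :: "'k::field" and n d :: nat and \<alpha> :: "int list"
  assumes "v \<noteq> 0"
    and "qfact v n \<noteq> 0"
    and "one_factor \<alpha>"
    and "length \<alpha> < n"
    and "int d = sum_list \<alpha>"
  shows "Phi1 (eta v \<alpha>) = eta v (app_plus \<alpha>)
    \<and> (d > 0 \<longrightarrow>
        Phi2 v (eta v \<alpha>)
          = (\<Sum>j=1..d. smul (qint v (int j)) (eta v (pair_defect j (app_plus \<alpha>))))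
      \<and> (\<Sum>j=1..d. smul (qint v (int j)) (eta v (pair_defect j (app_plus \<alpha>))))
          = smul (qint v (int d)) (eta v (app_minus \<alpha>))
            + (\<Sum>j=1..d - 1. smul (qint v (int j)) (eta v (app_plus (pair_defect j \<alpha>)))))"
proof (intro conjI impI)
  show "Phi1 (eta v \<alpha>) = eta v (app_plus \<alpha>)"
    using eta_append[OF assms(3) one_factor_single, of v]
    by (simp add: Phi1_def app_plus_def eta_single)
  show "Phi2 v (eta v \<alpha>)
      = (\<Sum>j=1..d. smul (qint v (int j)) (eta v (pair_defect j (app_plus \<alpha>))))"
    using Phi2_eta_sum[OF assms(1,3,5)] by (simp add: app_plus_def)
  assume "d > 0"
  then obtain k where k: "d = Suc k" by (cases d) auto
  have "pair_defect j (app_plus \<alpha>) = app_plus (pair_defect j \<alpha>)" if "j \<le> k" for j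
    unfolding app_plus_def
    using that k assms(3,5) by (intro pair_defect_append one_factor_single) auto
  then show "(\<Sum>j=1..d. smul (qint v (int j)) (eta v (pair_defect j (app_plus \<alpha>))))
          = smul (qint v (int d)) (eta v (app_minus \<alpha>))
            + (\<Sum>j=1..d - 1. smul (qint v (int j)) (eta v (app_plus (pair_defect j \<alpha>))))"
    using pair_defect_last[OF assms(3,5)] k
    by (simp add: app_plus_def app_minus_def add.commute del: of_nat_Suc)
qed

end
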